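(* Let $P,Q$ be coprime integers and let $(U_m)_{m\ge 0}$ be the Lucas sequence of the first kind with parameters $(P,Q)$. Let $k,n$ be positive integers with $U_k\neq 0$, and let $d=\gcd(n,k)$. Then $$\frac{U_{kn}}{U_k}\equiv\begin{cases} d\,U_{d+1}\cdot \dfrac{U_n}{U_d}\cdot Q^{\frac{kn-k-n}{2}}\pmod{U_n}, &\text{if } n,k \text{ are even and } \frac{n}{d},\frac{k}{d}\text{ are odd},\\[2mm] d\cdot \dfrac{U_n}{U_d}\cdot Q^{\frac{kn-k-n+d}{2}}\pmod{U_n}, & \text{otherwise.}\end{cases}$$
   Context: For integers $P,Q$, the Lucas sequence of the first kind $U_m=U_m(P,Q)$ is defined by $U_0=0$, $U_1=1$, $U_{m+1}=P\,U_m-Q\,U_{m-1}$ for $m\ge 1$. It satisfies $U_y\mid U_x$ whenever $y\mid x$, so the quotients $U_{kn}/U_k$ and $U_n/U_d$ are integers when $U_k\ne 0$ (which forces $U_d\neq 0$). The exponents of $Q$ appearing in the statement are nonnegative integers in the respective cases. A congruence modulo an integer $m$ means that the difference is a multiple of $m$. The convention $Q^0=1$ is used. *)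

theory Defs
  imports "HOL-Number_Theory.Cong"
begin

fun lucas_U :: "int \<Rightarrow> int \<Rightarrow> nat \<Rightarrow> int" where
  "lucas_U P Q 0 = 0"
| "lucas_U P Q (Suc 0) = 1"
| "lucas_U P Q (Suc (Suc m)) = P * lucas_U P Q (Suc m) - Q * lucas_U P Q m"

lemma lucas_U_add_Suc:
  "lucas_U P Q (Suc (m + n)) =
     lucas_U P Q (Suc m) * lucas_U P Q (Suc n) - Q * lucas_U P Q m * lucas_U P Q n"
proof (induction n arbitrary: m)
  case 0
  show ?case by simp
next
  case (Suc n)
  from Suc.IH[of "Suc m"] show ?case by (simp add: algebra_simps)
qed

text \<open>By this divisibility, \<open>lucas_U P Q x div lucas_U P Q y\<close> is the exact quotient
  whenever \<open>y dvd x\<close> and \<open>lucas_U P Q y \<noteq> 0\<close>.\<close>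

lemma lucas_U_dvd:
  assumes "y dvd x"
  shows "lucas_U P Q y dvd lucas_U P Q x"
proof (cases y)
  case 0
  with assms show ?thesis by simp
next
  case (Suc z)
  have "lucas_U P Q y dvd lucas_U P Q (y * j)" for j
  proof (induction j)
    case 0
    show ?case by simp
  next
    case (Suc j)
    have "lucas_U P Q (y * Suc j) = lucas_U P Q (Suc (y * j + z))"
      using \<open>y = Suc z\<close> by (simp add: algebra_simps)
    also have "\<dots> = lucas_U P Q (Suc (y * j)) * lucas_U P Q y
        - Q * lucas_U P Q (y * j) * lucas_U P Q z"
      using \<open>y = Suc z\<close> by (simp only: lucas_U_add_Suc)
    finally show ?case
      using Suc.IH by (simp add: dvd_diff)
  qed
  with assms show ?thesis by (auto elim: dvdE)
qed

end

theory Submission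
  imports Defs "HOL-Computational_Algebra.Polynomial"
begin

text \<open>
  Let \<open>\<alpha>, \<beta>\<close> be the roots of \<open>x\<^sup>2 - P x + Q\<close> and work in the ring \<open>\<int>[\<alpha>]\<close>. Then
  \<open>U\<^sub>k\<^sub>n / U\<^sub>k\<close> is the sum of \<open>\<alpha>\<^bsup>kj\<^esup> \<beta>\<^bsup>k(n-1-j)\<^esup>\<close> over \<open>j < n\<close>. Modulo \<open>U\<^sub>n\<close> we have
  \<open>\<alpha>\<^sup>n \<equiv> \<beta>\<^sup>n\<close>, so the summand only depends on \<open>kj mod n\<close>, which takes each multiple of \<open>d\<close>
  below \<open>n\<close> exactly \<open>d\<close> times. Hence \<open>U\<^sub>k\<^sub>n / U\<^sub>k \<equiv> d \<beta>\<^bsup>kn-k-n+d\<^esup> U\<^sub>n / U\<^sub>d\<close>, and it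
  remains to compute the power of \<open>\<beta>\<close> modulo \<open>U\<^sub>d\<close>, where \<open>\<beta>\<^sup>d \<equiv> U\<^sub>d\<^sub>+\<^sub>1\<close> and
  \<open>\<beta>\<^bsup>2d\<^esup> \<equiv> \<alpha>\<^sup>d \<beta>\<^sup>d = Q\<^sup>d\<close>.
\<close>

section \<open>Homogeneous geometric sums and sums over residues\<close>

definition homogeneous_geometric :: "'a::comm_ring_1 \<Rightarrow> 'a \<Rightarrow> nat \<Rightarrow> 'a" where
  "homogeneous_geometric x y n = (\<Sum>i<n. x ^ i * y ^ (n - 1 - i))"

lemma homogeneous_geometric_0 [simp]: "homogeneous_geometric x y 0 = 0"
  by (simp add: homogeneous_geometric_def)

lemma homogeneous_geometric_Suc:
  "homogeneous_geometric x y (Suc n) = x ^ n + y * homogeneous_geometric x y n"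
proof -
  have "(\<Sum>i<n. x ^ i * y ^ (n - i)) = (\<Sum>i<n. y * (x ^ i * y ^ (n - 1 - i)))"
  proof (rule sum.cong)
    fix i assume "i \<in> {..<n}"
    hence "n - i = Suc (n - 1 - i)" by auto
    thus "x ^ i * y ^ (n - i) = y * (x ^ i * y ^ (n - 1 - i))" by simp
  qed simp
  thus ?thesis by (simp add: homogeneous_geometric_def sum_distrib_left)
qed

text \<open>Multiplication by a unit modulo \<open>n\<close> permutes the residues, so the sum is
  merely reindexed.\<close>

lemma sum_mult_mod_coprime:
  fixes k n :: nat and f :: "nat \<Rightarrow> 'a::comm_monoid_add"
  assumes "coprime k n" and "n > 0"
  shows "(\<Sum>j<n. f (k * j mod n)) = (\<Sum>i<n. f i)"
proof -
  have inj: "inj_on (\<lambda>j. k * j mod n) {..<n}"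
  proof (rule inj_onI)
    fix i j assume "i \<in> {..<n}" "j \<in> {..<n}" "k * i mod n = k * j mod n"
    with assms(1) have "[i = j] (mod n)"
      by (metis cong_def cong_mult_lcancel_nat)
    with \<open>i \<in> {..<n}\<close> \<open>j \<in> {..<n}\<close> show "i = j" by (simp add: cong_def)
  qed
  moreover have "(\<lambda>j. k * j mod n) ` {..<n} \<subseteq> {..<n}" using assms(2) by auto
  ultimately have "(\<lambda>j. k * j mod n) ` {..<n} = {..<n}"
    by (intro endo_inj_surj) auto
  with sum.reindex[OF inj, of f] show ?thesis by simp
qed

text \<open>Write n = d n' and k = d k'. Then kj mod n = d (k'j mod n') has period n' in j, and each
  of the d blocks of n' consecutive indices meets every multiple of d below n once, as k' and n' are
  coprime.\<close>

lemma sum_mult_mod_gcd: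
  fixes k n :: nat and f :: "nat \<Rightarrow> 'a::semiring_1"
  assumes "n > 0"
  shows "(\<Sum>j<n. f (k * j mod n)) = of_nat (gcd n k) * (\<Sum>i<n div gcd n k. f (gcd n k * i))"
proof -
  define d where "d = gcd n k"
  define n' where "n' = n div d"
  define k' where "k' = k div d"
  have n: "n = d * n'" and k: "k = d * k'" by (auto simp: d_def n'_def k'_def)
  have pos: "n' > 0" using n assms by (cases n') auto
  have cop: "coprime k' n'"
    using assms unfolding k'_def n'_def d_def
    by (metis div_gcd_coprime gcd.commute gcd_eq_0_iff neq0_conv)
  have "(\<Sum>j<n. f (k * j mod n)) = (\<Sum>j<d * n'. f (d * (k' * j mod n')))"
    by (simp add: n k mult.assoc)
  also have "\<dots> = (\<Sum>m<d. \<Sum>j=m * n'..<m * n' + n'. f (d * (k' * j mod n')))"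
    by (simp add: sum.nat_group)
  also have "\<dots> = (\<Sum>m<d. \<Sum>j<n'. f (d * (k' * j mod n')))"
  proof (rule sum.cong)
    fix m
    have "(\<Sum>j=m * n'..<m * n' + n'. f (d * (k' * j mod n')))
        = (\<Sum>j<n'. f (d * (k' * (j + m * n') mod n')))"
      using sum.shift_bounds_nat_ivl[of "\<lambda>j. f (d * (k' * j mod n'))" 0 "m * n'" n']
      by (simp add: atLeast0LessThan add.commute)
    also have "\<dots> = (\<Sum>j<n'. f (d * (k' * j mod n')))"
      by (simp add: distrib_left mult.assoc[symmetric])
    finally show "(\<Sum>j=m * n'..<m * n' + n'. f (d * (k' * j mod n')))
        = (\<Sum>j<n'. f (d * (k' * j mod n')))" .
  qed simp
  also have "\<dots> = of_nat d * (\<Sum>i<n'. f (d * i))"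
    using sum_mult_mod_coprime[OF cop pos, of "\<lambda>i. f (d * i)"] by simp
  finally show ?thesis by (simp add: d_def n'_def)
qed

section \<open>The order Z[alpha] generated by a root\<close>

locale lucas_roots =
  fixes P Q :: int and \<alpha> \<beta> :: complex
  assumes sum_roots: "\<alpha> + \<beta> = of_int P" and prod_roots: "\<alpha> * \<beta> = of_int Q"
begin

lemma square_root: "\<alpha> * \<alpha> = of_int P * \<alpha> - of_int Q"
  unfolding sum_roots[symmetric] prod_roots[symmetric] by (simp add: algebra_simps)

text \<open>This is the ring Z[alpha]; \<open>square_root\<close> makes the span of 1 and alpha
  closed under products. The coordinates a, b need not be unique, since alpha may be
  rational.\<close>

definition order_ring :: "complex set" where
  "order_ring = {of_int a + of_int b * \<alpha> | a b. True}"

lemma of_int_in_order_ring [simp, intro]: "of_int a \<in> order_ring"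
  unfolding order_ring_def by (rule CollectI, rule exI[of _ a], rule exI[of _ 0]) simp

lemma of_nat_in_order_ring [simp, intro]: "of_nat a \<in> order_ring"
  using of_int_in_order_ring[of "int a"] by simp

lemma alpha_in_order_ring [simp, intro]: "\<alpha> \<in> order_ring"
  unfolding order_ring_def by (rule CollectI, rule exI[of _ 0], rule exI[of _ 1]) simp

lemma add_in_order_ring [intro]:
  assumes "x \<in> order_ring" "y \<in> order_ring"
  shows "x + y \<in> order_ring"
proof -
  from assms obtain a b a' b' where "x = of_int a + of_int b * \<alpha>" "y = of_int a' + of_int b' * \<alpha>"
    unfolding order_ring_def by auto
  hence "x + y = of_int (a + a') + of_int (b + b') * \<alpha>" by (simp add: algebra_simps)
  thus ?thesis unfolding order_ring_def by blast
qed

lemma mult_in_order_ring [intro]: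
  assumes "x \<in> order_ring" "y \<in> order_ring"
  shows "x * y \<in> order_ring"
proof -
  from assms obtain a b a' b' where "x = of_int a + of_int b * \<alpha>" "y = of_int a' + of_int b' * \<alpha>"
    unfolding order_ring_def by auto
  hence "x * y = of_int (a * a') + of_int (a * b' + a' * b) * \<alpha> + of_int (b * b') * (\<alpha> * \<alpha>)"
    by (simp add: algebra_simps)
  also have "\<dots> = of_int (a * a' - b * b' * Q) + of_int (a * b' + a' * b + b * b' * P) * \<alpha>"
    unfolding square_root by (simp add: algebra_simps)
  finally show ?thesis unfolding order_ring_def by blast
qed

lemma uminus_in_order_ring [intro]: "x \<in> order_ring \<Longrightarrow> - x \<in> order_ring"
  using mult_in_order_ring[OF of_int_in_order_ring[of "-1"], of x] by simp

lemma diff_in_order_ring [intro]: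
  "x \<in> order_ring \<Longrightarrow> y \<in> order_ring \<Longrightarrow> x - y \<in> order_ring"
  using add_in_order_ring[OF _ uminus_in_order_ring] by simp

lemma beta_in_order_ring [simp, intro]: "\<beta> \<in> order_ring"
proof -
  have "\<beta> = of_int P - \<alpha>" by (simp flip: sum_roots)
  thus ?thesis by auto
qed

lemma power_in_order_ring [intro]: "x \<in> order_ring \<Longrightarrow> x ^ m \<in> order_ring"
  by (induction m) (use of_int_in_order_ring[of 1] in auto)

lemma sum_in_order_ring [intro]:
  "(\<And>i. i \<in> A \<Longrightarrow> f i \<in> order_ring) \<Longrightarrow> sum f A \<in> order_ring"
  by (induction A rule: infinite_finite_induct) (use of_int_in_order_ring[of 0] in auto)

text \<open>Elements of Z[alpha] are algebraic integers, and a rational algebraic integer is an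
  integer. This is what brings congruences in Z[alpha] back to Z.\<close>

lemma rational_in_order_ring:
  assumes "x \<in> order_ring" "x \<in> \<rat>"
  shows "x \<in> \<int>"
proof -
  from assms(1) obtain a b where x: "x = of_int a + of_int b * \<alpha>"
    unfolding order_ring_def by auto
  \<comment> \<open>\<open>p\<close> is (X - a - b alpha)(X - a - b beta), expanded through the sum
    P and the product Q of the roots.\<close>
  define p :: "complex poly" where
    "p = [:of_int (a * a + a * b * P + b * b * Q), of_int (- (2 * a + b * P)), 1:]"
  have "poly p x = of_int (b * b) * (\<alpha> * \<alpha> - of_int P * \<alpha> + of_int Q)"
    by (simp add: p_def x algebra_simps)
  hence "poly p x = 0" by (simp add: square_root)
  moreover have "coeff p i \<in> \<int>" for i
    unfolding p_def by (auto simp del: of_int_add of_int_mult of_int_minus simp: coeff_pCons split: nat.splits)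
  ultimately have "algebraic_int x"
    by (intro algebraic_int.intros[of p]) (auto simp: p_def)
  with assms(2) show ?thesis by (rule rational_algebraic_int_is_int[rotated])
qed

section \<open>Congruences in Z[alpha] modulo an integer\<close>

definition rcong :: "int \<Rightarrow> complex \<Rightarrow> complex \<Rightarrow> bool" where
  "rcong m x y \<longleftrightarrow> (\<exists>z\<in>order_ring. x - y = of_int m * z)"

lemma rcongI: "x - y = of_int m * z \<Longrightarrow> z \<in> order_ring \<Longrightarrow> rcong m x y"
  by (auto simp: rcong_def)

lemma rcong_refl [simp]: "rcong m x x"
  using of_int_in_order_ring[of 0] by (auto simp: rcong_def)

lemma rcong_sym:
  assumes "rcong m x y"
  shows "rcong m y x"
proof -
  from assms obtain u where u: "u \<in> order_ring" "x - y = of_int m * u" by (auto simp: rcong_def)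
  have "y - x = of_int m * (- u)" using u(2) by (simp add: algebra_simps)
  thus ?thesis by (rule rcongI) (use u(1) in auto)
qed

lemma rcong_trans [trans]:
  assumes "rcong m x y" "rcong m y z"
  shows "rcong m x z"
proof -
  from assms obtain u v where uv: "u \<in> order_ring" "v \<in> order_ring"
    "x - y = of_int m * u" "y - z = of_int m * v" by (auto simp: rcong_def)
  have "x - z = (x - y) + (y - z)" by simp
  also have "\<dots> = of_int m * (u + v)" using uv by (simp add: distrib_left)
  finally show ?thesis by (rule rcongI) (use uv(1,2) in auto)
qed

lemma rcong_mult_left:
  assumes "rcong m x y" "c \<in> order_ring"
  shows "rcong m (c * x) (c * y)"
proof -
  from assms(1) obtain u where u: "u \<in> order_ring" "x - y = of_int m * u" by (auto simp: rcong_def)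
  have "c * x - c * y = of_int m * (c * u)"
    using u(2) by (simp add: right_diff_distrib[symmetric])
  thus ?thesis by (rule rcongI) (use u(1) assms(2) in auto)
qed

lemma rcong_power:
  assumes "rcong m x y" "x \<in> order_ring" "y \<in> order_ring"
  shows "rcong m (x ^ e) (y ^ e)"
proof (induction e)
  case (Suc e)
  have "rcong m (x * x ^ e) (x * y ^ e)" using Suc assms(2) by (rule rcong_mult_left)
  also have "rcong m (x * y ^ e) (y * y ^ e)"
    using rcong_mult_left[OF assms(1) power_in_order_ring[OF assms(3)], of e]
    by (simp add: mult.commute)
  finally show ?case by simp
qed simp

lemma rcong_sum:
  assumes "\<And>i. i \<in> A \<Longrightarrow> rcong m (f i) (g i)"
  shows "rcong m (sum f A) (sum g A)"
proof -
  from assms have "\<forall>i. \<exists>z. i \<in> A \<longrightarrow> z \<in> order_ring \<and> f i - g i = of_int m * z"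
    unfolding rcong_def by blast
  then obtain z where z: "\<And>i. i \<in> A \<Longrightarrow> z i \<in> order_ring"
    "\<And>i. i \<in> A \<Longrightarrow> f i - g i = of_int m * z i" by metis
  have "sum f A - sum g A = of_int m * sum z A"
    unfolding sum_subtractf[symmetric] sum_distrib_left by (rule sum.cong) (auto simp: z)
  thus ?thesis by (rule rcongI) (use z(1) in auto)
qed

text \<open>Scaling the modulus too lets a power of beta be computed modulo U_d only: the factor d
  U_n / U_d turns the modulus into d U_n.\<close>

lemma rcong_mult_modulus:
  assumes "rcong m x y"
  shows "rcong (m * c) (of_int c * x) (of_int c * y)"
proof -
  from assms obtain u where u: "u \<in> order_ring" "x - y = of_int m * u" by (auto simp: rcong_def)
  have "of_int c * x - of_int c * y = of_int (m * c) * u"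
    using u(2) by (simp add: right_diff_distrib[symmetric])
  thus ?thesis using u(1) by (rule rcongI)
qed

text \<open>For nonzero m the cofactor (x - y)/m is rational and lies in Z[alpha], hence is an
  integer; for m = 0 both congruences are equalities.\<close>

lemma rcong_of_int_imp_cong:
  assumes "rcong m (of_int x) (of_int y)"
  shows "[x = y] (mod m)"
proof (cases "m = 0")
  case True
  with assms show ?thesis by (auto simp: rcong_def)
next
  case False
  from assms obtain z where z: "z \<in> order_ring" "of_int x - of_int y = of_int m * z"
    by (auto simp: rcong_def)
  have "z = of_int (x - y) / of_int m" using z(2) False by (simp add: field_simps)
  hence "z \<in> \<rat>" by simp
  with z(1) have "z \<in> \<int>" by (rule rational_in_order_ring)
  then obtain c where "z = of_int c" by (rule Ints_cases)
  with z(2) have "of_int (x - y) = (of_int (m * c) :: complex)" by simp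
  hence "x - y = m * c" by (simp only: of_int_eq_iff)
  thus ?thesis by (simp add: cong_iff_dvd_diff)
qed

section \<open>Lucas numbers and powers of the roots\<close>

abbreviation "U \<equiv> lucas_U P Q"

text \<open>A division-free substitute for (alpha^m - beta^m)/(alpha - beta), valid also for a
  double root.\<close>

lemma U_Suc_alpha: "of_int (U (Suc m)) = \<alpha> ^ m + \<beta> * of_int (U m)"
proof (induction m)
  case (Suc m)
  have "of_int (U (Suc (Suc m))) = (\<alpha> + \<beta>) * of_int (U (Suc m)) - \<alpha> * \<beta> * of_int (U m)"
    by (simp add: sum_roots prod_roots)
  also have "\<dots> = \<alpha> * (of_int (U (Suc m)) - \<beta> * of_int (U m)) + \<beta> * of_int (U (Suc m))"
    by (simp add: algebra_simps)
  finally show ?case using Suc by (simp add: algebra_simps)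
qed simp

lemma U_add: "of_int (U (m + k)) = \<alpha> ^ m * of_int (U k) + \<beta> ^ k * of_int (U m)"
proof (induction k)
  case (Suc k)
  have "of_int (U (m + Suc k)) = \<alpha> ^ (m + k) + \<beta> * of_int (U (m + k))"
    using U_Suc_alpha[of "m + k"] by simp
  also have "\<dots> = \<alpha> ^ m * (\<alpha> ^ k + \<beta> * of_int (U k)) + \<beta> ^ Suc k * of_int (U m)"
    unfolding Suc by (simp add: power_add algebra_simps)
  finally show ?case by (simp only: U_Suc_alpha)
qed simp

text \<open>Induction on j with \<open>U_add\<close>. The homogeneous sum stands for (x^j - y^j)/(x
  - y) at x = alpha^k, y = beta^k, and also covers x = y.\<close>

lemma U_mult:
  "of_int (U (k * j)) = of_int (U k) * homogeneous_geometric (\<alpha> ^ k) (\<beta> ^ k) j"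
proof (induction j)
  case (Suc j)
  have "of_int (U (k * Suc j)) = \<alpha> ^ (k * j) * of_int (U k) + \<beta> ^ k * of_int (U (k * j))"
    using U_add[of "k * j" k] by (simp add: add.commute)
  also have "\<dots> = of_int (U k) * ((\<alpha> ^ k) ^ j + \<beta> ^ k * homogeneous_geometric (\<alpha> ^ k) (\<beta> ^ k) j)"
    unfolding Suc power_mult by (simp add: algebra_simps)
  finally show ?case by (simp only: homogeneous_geometric_Suc)
qed simp

lemma U_quotient:
  assumes "U k \<noteq> 0"
  shows "of_int (U (k * j) div U k) = homogeneous_geometric (\<alpha> ^ k) (\<beta> ^ k) j"
proof -
  have "U k dvd U (k * j)" by (rule lucas_U_dvd) simp
  then obtain c where c: "U (k * j) = U k * c" ..
  hence "of_int (U k) * of_int c = of_int (U k) * homogeneous_geometric (\<alpha> ^ k) (\<beta> ^ k) j"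
    using U_mult[of k j] by simp
  with assms c show ?thesis by simp
qed

lemma rcong_alpha_power_beta_power: "rcong (U n) (\<alpha> ^ n) (\<beta> ^ n)"
proof (rule rcongI)
  \<comment> \<open>The two ways of splitting U_{n+1}, as n + 1 and as 1 + n, are
    subtracted.\<close>
  show "\<alpha> ^ n - \<beta> ^ n = of_int (U n) * (\<alpha> - \<beta>)"
    using U_add[of n 1] U_add[of 1 n] by (simp add: algebra_simps)
qed auto

lemma rcong_beta_power_U: "rcong (U d) (\<beta> ^ d) (of_int (U (Suc d)))"
proof (rule rcongI)
  show "\<beta> ^ d - of_int (U (Suc d)) = of_int (U d) * (- \<alpha>)"
    using U_add[of 1 d] by simp
qed auto

lemma rcong_beta_power_double: "rcong (U d) (\<beta> ^ (d * (2 * e))) (of_int (Q ^ (d * e)))"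
proof -
  have "rcong (U d) (\<beta> ^ d * \<alpha> ^ d) (\<beta> ^ d * \<beta> ^ d)"
    by (intro rcong_mult_left rcong_alpha_power_beta_power) auto
  hence "rcong (U d) (\<beta> ^ d * \<beta> ^ d) (\<beta> ^ d * \<alpha> ^ d)"
    by (rule rcong_sym)
  hence "rcong (U d) ((\<beta> ^ d * \<beta> ^ d) ^ e) ((\<beta> ^ d * \<alpha> ^ d) ^ e)"
    by (rule rcong_power) auto
  moreover have "(\<beta> ^ d * \<beta> ^ d) ^ e = \<beta> ^ (d * (2 * e))"
  proof -
    have "d * (2 * e) = (d + d) * e" by simp
    thus ?thesis by (simp only: power_mult power_add)
  qed
  moreover have "(\<beta> ^ d * \<alpha> ^ d) ^ e = of_int (Q ^ (d * e))"
  proof -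
    have "\<beta> ^ d * \<alpha> ^ d = of_int Q ^ d"
      by (simp only: power_mult_distrib mult.commute flip: prod_roots)
    thus ?thesis by (simp add: power_mult)
  qed
  ultimately show ?thesis by simp
qed

section \<open>The quotient U_{kn} / U_k modulo U_n\<close>

lemma rcong_quotient:
  assumes "k > 0" "n > 0" "U k \<noteq> 0" and d: "d = gcd n k"
  shows "rcong (U n) (of_int (U (k * n) div U k))
    (of_int (int d * (U n div U d)) * \<beta> ^ (k * n + d - (k + n)))"
proof -
  define n' where "n' = n div d"
  have n: "n = d * n'" by (simp add: n'_def d)
  have dpos: "d > 0" using assms by simp
  have n'pos: "n' > 0" using n assms(2) by (cases n') auto
  have Ud: "U d \<noteq> 0"
    using lucas_U_dvd[of d k P Q] assms(3) d by auto
  have dk: "d \<le> k" using assms by (simp add: gcd_le2_nat)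
  \<comment> \<open>With kj = nq + r, the factor (alpha^n)^q is traded for (beta^n)^q. The total
    degree k(n - 1) is kept, so the result depends only on r.\<close>
  have summand: "rcong (U n) ((\<alpha> ^ k) ^ j * (\<beta> ^ k) ^ (n - 1 - j))
      (\<alpha> ^ (k * j mod n) * \<beta> ^ (k * n - k - k * j mod n))" if "j < n" for j
  proof -
    define q r where "q = k * j div n" and "r = k * j mod n"
    have kj: "k * j = n * q + r" by (simp add: q_def r_def)
    \<comment> \<open>The resulting bound makes the truncated subtraction in kn - k - kj
      exact.\<close>
    have "Suc j \<le> n" using that by simp
    hence "k * Suc j \<le> k * n" by (rule mult_le_mono2)
    hence le: "k + k * j \<le> k * n" by simp
    have e: "k * (n - 1 - j) = k * n - k - k * j"
      by (simp add: diff_mult_distrib2)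
    have "(\<alpha> ^ k) ^ j * (\<beta> ^ k) ^ (n - 1 - j) = (\<alpha> ^ r * \<beta> ^ (k * n - k - k * j)) * (\<alpha> ^ n) ^ q"
      unfolding power_mult[symmetric] e unfolding kj by (simp add: power_add power_mult mult_ac)
    also have "rcong (U n) \<dots> ((\<alpha> ^ r * \<beta> ^ (k * n - k - k * j)) * (\<beta> ^ n) ^ q)"
      by (intro rcong_mult_left rcong_power rcong_alpha_power_beta_power) auto
    also have "(\<alpha> ^ r * \<beta> ^ (k * n - k - k * j)) * (\<beta> ^ n) ^ q
        = \<alpha> ^ r * \<beta> ^ (k * n - k - k * j + n * q)"
      by (simp add: power_add power_mult mult_ac)
    also have "k * n - k - k * j + n * q = k * n - k - r" using kj le by linarith
    finally show ?thesis by (simp add: r_def)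
  qed
  have "of_int (U (k * n) div U k) = (\<Sum>j<n. (\<alpha> ^ k) ^ j * (\<beta> ^ k) ^ (n - 1 - j))"
    by (simp add: U_quotient[OF assms(3)] homogeneous_geometric_def)
  also have "rcong (U n) \<dots> (\<Sum>j<n. \<alpha> ^ (k * j mod n) * \<beta> ^ (k * n - k - k * j mod n))"
    by (rule rcong_sum) (use summand in auto)
  also have "(\<Sum>j<n. \<alpha> ^ (k * j mod n) * \<beta> ^ (k * n - k - k * j mod n))
      = of_nat d * (\<Sum>i<n'. \<alpha> ^ (d * i) * \<beta> ^ (k * n - k - d * i))"
    unfolding n'_def d
    by (rule sum_mult_mod_gcd[OF assms(2), of "\<lambda>r. \<alpha> ^ r * \<beta> ^ (k * n - k - r)"])
  \<comment> \<open>A fixed power of beta splits off; what remains has degree n - d and sums to U_n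
    / U_d.\<close>
  also have "(\<Sum>i<n'. \<alpha> ^ (d * i) * \<beta> ^ (k * n - k - d * i))
      = (\<Sum>i<n'. ((\<alpha> ^ d) ^ i * (\<beta> ^ d) ^ (n' - 1 - i)) * \<beta> ^ (k * n + d - (k + n)))"
  proof (rule sum.cong)
    fix i assume "i \<in> {..<n'}"
    hence i: "Suc i \<le> n'" by simp
    have "d * Suc i \<le> d * n'" using i by (rule mult_le_mono2)
    hence di: "d + d * i \<le> n" by (simp add: n)
    have "d * (n' - 1 - i) = n - d - d * i" by (simp add: n diff_mult_distrib2)
    \<comment> \<open>The exponent of beta is a genuine difference: for k = d + a it equals a(n - 1)
      + (d - 1)n.\<close>
    moreover have "k + n \<le> k * n + d"
    proof -
      obtain a where k: "k = d + a" using dk le_Suc_ex by blast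
      have "a \<le> a * n" "n \<le> d * n" using assms(2) dpos by simp_all
      hence "a + n \<le> a * n + d * n" by (rule add_mono)
      thus ?thesis using k by (simp add: algebra_simps)
    qed
    ultimately have "k * n - k - d * i = d * (n' - 1 - i) + (k * n + d - (k + n))"
      using di by linarith
    thus "\<alpha> ^ (d * i) * \<beta> ^ (k * n - k - d * i)
        = ((\<alpha> ^ d) ^ i * (\<beta> ^ d) ^ (n' - 1 - i)) * \<beta> ^ (k * n + d - (k + n))"
      by (simp add: power_add power_mult)
  qed simp
  also have "\<dots> = of_int (U n div U d) * \<beta> ^ (k * n + d - (k + n))"
    using U_quotient[OF Ud, of n']
    by (simp add: n homogeneous_geometric_def sum_distrib_right)
  finally show ?thesis by (simp add: mult.assoc)
qed

end

section \<open>Existence of the roots and descent to the integers\<close>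

lemma lucas_roots_exist: "\<exists>\<alpha> \<beta>. lucas_roots P Q \<alpha> \<beta>"
proof -
  define s where "s = csqrt (of_int (P * P - 4 * Q))"
  have s: "s * s = of_int (P * P - 4 * Q)"
    unfolding s_def by (simp flip: power2_eq_square)
  have "lucas_roots P Q ((of_int P + s) / 2) ((of_int P - s) / 2)"
    by unfold_locales (auto simp: field_simps s)
  thus ?thesis by blast
qed

theorem theorem4p1:
  fixes P Q :: int and k n d :: nat
  assumes "coprime P Q"
    and "k > 0" and "n > 0"
    and "lucas_U P Q k \<noteq> 0"
    and "d = gcd n k"
  shows "[lucas_U P Q (k * n) div lucas_U P Q k =
      (if even n \<and> even k \<and> odd (n div d) \<and> odd (k div d)
       then int d * lucas_U P Q (d + 1) * (lucas_U P Q n div lucas_U P Q d)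
              * Q ^ ((k * n - (k + n)) div 2)
       else int d * (lucas_U P Q n div lucas_U P Q d)
              * Q ^ ((k * n + d - (k + n)) div 2))]
      (mod (lucas_U P Q n))"
proof -
  obtain \<alpha> \<beta> where "lucas_roots P Q \<alpha> \<beta>" using lucas_roots_exist by blast
  then interpret lucas_roots P Q \<alpha> \<beta> .
  define n' k' where "n' = n div d" and "k' = k div d"
  have n: "n = d * n'" and k: "k = d * k'" by (auto simp: n'_def k'_def assms(5))
  have dpos: "d > 0" using assms by simp
  have pos: "n' > 0" "k' > 0" using n k assms(2,3) by (auto intro!: gr0I)
  have cop: "coprime n' k'"
    using assms(3) unfolding n'_def k'_def assms(5) by (intro div_gcd_coprime) auto
  define X where "X = int d * (U n div U d)"
  \<comment> \<open>d e is the exponent kn + d - k - n of beta. The bound \<open>le\<close> makes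
    the subtraction exact, which the parity count \<open>par\<close> needs.\<close>
  define e where "e = k * n' + 1 - (k' + n')"
  have le: "k' + n' \<le> k * n' + 1"
  proof -
    \<comment> \<open>This is (k' - 1)(n' - 1) >= 0.\<close>
    have "k' + n' \<le> k' * n' + 1" using pos by (cases k'; cases n') auto
    moreover have "k' * n' \<le> k * n'" using dpos by (simp add: k)
    ultimately show ?thesis by linarith
  qed
  have E: "k * n + d - (k + n) = d * e"
    unfolding e_def by (simp add: n diff_mult_distrib2 distrib_left)
       (simp add: k algebra_simps)
  \<comment> \<open>A congruence for beta^(de) modulo U_d, multiplied by X = d U_n / U_d, holds
    modulo d U_n and so modulo U_n.\<close>
  have transfer: "[U (k * n) div U k = X * c] (mod U n)" if "rcong (U d) (\<beta> ^ (d * e)) (of_int c)" for c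
  proof -
    have "U d dvd U n" by (rule lucas_U_dvd) (simp add: n)
    hence modulus: "U d * X = U n * int d" by (simp add: X_def)
    have "rcong (U n * int d) (of_int X * \<beta> ^ (d * e)) (of_int X * of_int c)"
      using rcong_mult_modulus[OF that, of X] by (simp only: modulus)
    then obtain z where "z \<in> order_ring"
      "of_int X * \<beta> ^ (d * e) - of_int X * of_int c = of_int (U n * int d) * z"
      by (auto simp: rcong_def)
    hence "rcong (U n) (of_int X * \<beta> ^ (d * e)) (of_int X * of_int c)"
      by (intro rcongI[of _ _ _ "of_nat d * z"]) (auto simp: mult.assoc)
    with rcong_quotient[OF assms(2-5)]
    have "rcong (U n) (of_int (U (k * n) div U k)) (of_int (X * c))"
      unfolding E X_def[symmetric] of_int_mult[of X c] by (rule rcong_trans)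
    thus ?thesis by (rule rcong_of_int_imp_cong)
  qed
  \<comment> \<open>For even d, e has the parity of k' + n' + 1, which is odd exactly when k' and n'
    are both odd, as they are not both even. For odd d, e has the parity of (k' + 1)(n' + 1), which
    is odd only if both are even, contradicting coprimality.\<close>
  have par: "odd e \<longleftrightarrow> even n \<and> even k \<and> odd n' \<and> odd k'"
  proof -
    have "\<not> (even n' \<and> even k')" using cop by (meson coprime_common_divisor odd_one)
    moreover have "odd e \<longleftrightarrow> odd (k * n' + 1 + (k' + n'))" using le unfolding e_def by simp
    ultimately show ?thesis unfolding n k by auto
  qed
  show ?thesis
  proof (cases "odd e")
    case True
    then obtain f where f: "e = 2 * f + 1" by (rule oddE)
    \<comment> \<open>Here de = 2df + d: the even part contributes Q^(df), and the leftover beta^d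
      contributes U_{d+1}.\<close>
    have "rcong (U d) (\<beta> ^ (d * (2 * f)) * \<beta> ^ d) (\<beta> ^ (d * (2 * f)) * of_int (U (Suc d)))"
      by (intro rcong_mult_left rcong_beta_power_U) auto
    also have "rcong (U d) \<dots> (of_int (Q ^ (d * f)) * of_int (U (Suc d)))"
      using rcong_mult_left[OF rcong_beta_power_double[of d f] of_int_in_order_ring[of "U (Suc d)"]]
      by (simp only: mult.commute)
    finally have "rcong (U d) (\<beta> ^ (d * e)) (of_int (Q ^ (d * f) * U (Suc d)))"
      by (simp add: f power_add distrib_left mult.commute)
    hence "[U (k * n) div U k = X * (Q ^ (d * f) * U (Suc d))] (mod U n)" by (rule transfer)
    moreover have "(k * n - (k + n)) div 2 = d * f"
    proof -
      have "k * n + d - (k + n) = 2 * (d * f) + d" using E by (simp add: f algebra_simps)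
      \<comment> \<open>Positivity of d excludes truncation on the left of the previous equation, so
        d can be cancelled.\<close>
      hence "k * n - (k + n) = 2 * (d * f)" using dpos by linarith
      thus ?thesis by simp
    qed
    ultimately show ?thesis using True par by (simp add: X_def n'_def k'_def mult_ac)
  next
    case False
    then obtain f where f: "e = 2 * f" by (auto elim: evenE)
    hence "[U (k * n) div U k = X * Q ^ (d * f)] (mod U n)"
      using rcong_beta_power_double[of d f] by (intro transfer) simp
    moreover have "(k * n + d - (k + n)) div 2 = d * f" using E by (simp add: f)
    ultimately show ?thesis using False par by (auto simp: X_def n'_def k'_def)
  qed
qed

end
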